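(* Let $M$ be a matroid on a ground set $E$ with rank function $r$. Let $s_1<s_2<\dots<s_k$ be the distinct values of the universal density $\eta^*$ of $M$. For $i=1,\dots,k$, put $E_i:=\{e\in E:\eta^*(e)\ge s_i\}$, $b_i:=\lfloor |E_i|s_i\rfloor$ and $c_i:=\lfloor |E_i|s_i\rfloor+r(E-E_i)$, where $\lfloor\cdot\rfloor$ is the floor function. Put $c_0:=0$. For $t=1,\dots,r(M)$, let $\eta_t^*$ be the universal density of the $t$-truncation $M_t$ of $M$. Then: (i) $b_i$ is the balancity of the contraction $M/(E-E_i)$ for $i=1,\dots,k$; (ii) $0=c_0<c_1\le c_2\le\dots\le c_{k-1}<c_k=r(M)$; (iii) $c_i-b_i=r(E-E_i)\le c_{i-1}$ for $i=1,\dots,k$; (iv) for $i=1,\dots,k$ and every integer $t$ such that $c_{i-1}<t\le c_i$, $$\eta_t^*(e)=\begin{cases}\dfrac{t-r(E-E_i)}{|E_i|} & \text{if } e\in E_i,\\[2mm] \eta^*(e) & \text{if } e\in E-E_i.\end{cases}$$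
   Context: All matroids are finite, loopless and of positive rank; $r(M)=r(E)$. For a matroid $M$ on $E$ with set of bases $\mathcal B(M)$, $\operatorname{conv}(\mathcal B(M))\subset\mathbb R^E$ is the convex hull of the indicator vectors of the bases. The universal density $\eta^*=\eta^*_M$ of $M$ is the unique minimizer of $\sum_{e\in E}\eta(e)^2$ over $\eta\in\operatorname{conv}(\mathcal B(M))$. $M$ is homogeneous if $\eta^*_M$ is a constant vector. For an integer $1\le t\le r(M)$, the $t$-truncation $M_t$ is the matroid on $E$ whose independent sets are the independent sets of $M$ of size at most $t$. The balancity of a matroid $M$ is the largest integer $t$ with $1\le t\le r(M)$ such that $M_t$ is homogeneous. $M/X$ denotes matroid contraction of $X$ (a matroid on $E-X$), with rank function $r_{M/X}(Y)=r(X\cup Y)-r(X)$. *)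

theory Defs
  imports "HOL-Analysis.Analysis" "HOL-Library.Function_Algebras"
begin

text \<open>A matroid is given by its ground set \<open>E\<close> and its family \<open>I\<close> of independent sets.\<close>

locale matroid =
  fixes E :: "'a set" and I :: "'a set set"
  assumes finite_ground: "finite E"
    and indep_subset_ground: "A \<in> I \<Longrightarrow> A \<subseteq> E"
    and empty_indep: "{} \<in> I"
    and indep_subset: "A \<in> I \<Longrightarrow> B \<subseteq> A \<Longrightarrow> B \<in> I"
    and augment: "A \<in> I \<Longrightarrow> B \<in> I \<Longrightarrow> card A < card B \<Longrightarrow> \<exists>e\<in>B - A. insert e A \<in> I"

definition matroid_rank :: "'a set set \<Rightarrow> 'a set \<Rightarrow> nat" where
  "matroid_rank I X = Max {card A | A. A \<in> I \<and> A \<subseteq> X}"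

locale loopless_matroid = matroid +
  assumes loopless: "e \<in> E \<Longrightarrow> {e} \<in> I"
    and positive_rank: "matroid_rank I E > 0"

definition bases :: "'a set set \<Rightarrow> 'a set set" where
  "bases I = {B \<in> I. \<forall>A\<in>I. B \<subseteq> A \<longrightarrow> A = B}"

definition truncation :: "nat \<Rightarrow> 'a set set \<Rightarrow> 'a set set" where
  "truncation t I = {A \<in> I. card A \<le> t}"

text \<open>The independent sets of \<open>M/X\<close>, a matroid on \<open>E - X\<close>: those \<open>Y\<close> with
  \<open>r (X \<union> Y) - r X = card Y\<close>.\<close>

definition contraction :: "'a set \<Rightarrow> 'a set set \<Rightarrow> 'a set \<Rightarrow> 'a set set" where
  "contraction E I X = {Y. Y \<subseteq> E - X \<and> matroid_rank I (X \<union> Y) = matroid_rank I X + card Y}"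

text \<open>The pointwise real vector space structure on functions, so that \<open>convex hull\<close> applies.\<close>

instantiation "fun" :: (type, real_vector) real_vector
begin

definition scaleR_fun :: "real \<Rightarrow> ('a \<Rightarrow> 'b) \<Rightarrow> 'a \<Rightarrow> 'b" where
  "scaleR_fun c f = (\<lambda>x. c *\<^sub>R f x)"

instance
  by standard (simp_all add: scaleR_fun_def fun_eq_iff scaleR_add_right scaleR_add_left)

end

text \<open>A vector in \<open>\<real>\<^sup>E\<close> is a function on the ambient type; every point of the base polytope
  vanishes outside the ground set, so the minimizer below is unique as a function.\<close>

definition base_polytope :: "'a set set \<Rightarrow> ('a \<Rightarrow> real) set" where
  "base_polytope I = convex hull (indicator ` bases I)"

definition universal_density :: "'a set \<Rightarrow> 'a set set \<Rightarrow> 'a \<Rightarrow> real" where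
  "universal_density E I = (THE \<eta>. \<eta> \<in> base_polytope I \<and>
     (\<forall>\<zeta>\<in>base_polytope I. (\<Sum>e\<in>E. (\<eta> e)\<^sup>2) \<le> (\<Sum>e\<in>E. (\<zeta> e)\<^sup>2)))"

definition homogeneous :: "'a set \<Rightarrow> 'a set set \<Rightarrow> bool" where
  "homogeneous E I \<longleftrightarrow> universal_density E I constant_on E"

definition balancity :: "'a set \<Rightarrow> 'a set set \<Rightarrow> nat" where
  "balancity E I =
     (GREATEST t. 1 \<le> t \<and> t \<le> matroid_rank I E \<and> homogeneous E (truncation t I))"

end

theory Submission
  imports Defs
begin

text \<open>Everything rests on one description of the universal density: a point of the base polytope is
  the universal density exactly when each of its strict lower level sets \<open>L = {e. \<eta> e < u}\<close> is
  \<^emph>\<open>tight\<close>, that is, \<open>\<eta>(L) = r(L)\<close>. If some level set is not tight, a little mass can be moved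
  from a larger coordinate to a smaller one, which lowers the sum of squares
  (\<open>minimizer_tight_levels\<close>). If all are tight, then no other point of the polytope puts more
  mass on a lower level set, and summation by parts shows that \<open>\<eta>\<close> is the strict minimizer
  (\<open>tight_levels_strict_minimum\<close>). To apply this criterion one must recognize the points of the
  base polytope from inequalities; this is Edmonds' theorem \<open>base_polytope_eq\<close>: the polytope
  consists of the nonnegative vectors \<open>x\<close> with \<open>x(A) \<le> r(A)\<close> for all \<open>A\<close> and \<open>x(E) = r(E)\<close>.

  The criterion makes two constructions explicit. Capping \<open>\<eta>*\<close> at a height \<open>u\<close> for which the total
  becomes an integer \<open>t\<close> keeps the level sets below \<open>u\<close> tight, and the only other one is all of \<open>E\<close>,
  which is tight in the truncation; so the density of \<open>M_t\<close> is \<open>min \<eta>* u\<close>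
  (\<open>universal_density_truncation\<close>). Contracting a lower level set \<open>X\<close> subtracts \<open>r(X) = \<eta>*(X)\<close> from
  both sides of every inequality, so the density of \<open>M/X\<close> is the restriction of \<open>\<eta>*\<close>
  (\<open>universal_density_contraction\<close>).

  Consequently \<open>M_t\<close> is homogeneous exactly when \<open>t \<le> |E| min \<eta>*\<close>: capping gives one direction, and
  for the other a constant vector larger than \<open>min \<eta>*\<close> violates the rank inequality of the set
  where \<open>\<eta>*\<close> is minimal. So the balancity is \<open>\<lfloor>|E| min \<eta>*\<rfloor>\<close> (\<open>balancity_eq\<close>), and applying this to
  \<open>M/(E - E_i)\<close>, whose smallest density is \<open>s_i\<close>, gives (i).

  For (ii)-(iv), let \<open>G(u) = \<Sum>e. min (\<eta>* e) u\<close>. On the interval \<open>[s_(i-1), s_i]\<close> (with \<open>s_0 = 0\<close>)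
  this function is the line \<open>|E_i| u + r(E - E_i)\<close>, hence \<open>c_i = \<lfloor>G(s_i)\<rfloor>\<close>. Monotonicity of \<open>G\<close> and
  these lines give (ii) and (iii). An integer \<open>t\<close> with \<open>c_(i-1) < t \<le> c_i\<close> lies in
  \<open>(G(s_(i-1)), G(s_i)]\<close>, so \<open>G(u) = t\<close> is solved on the \<open>i\<close>-th line, and capping \<open>\<eta>*\<close> at this \<open>u\<close>
  gives (iv).\<close>

section \<open>Rank\<close>

context matroid
begin

lemma finite_indep: "A \<in> I \<Longrightarrow> finite A"
  using finite_ground finite_subset indep_subset_ground by blast

lemma finite_indep_sets: "finite I"
  using finite_subset[of I "Pow E"] finite_ground indep_subset_ground by blast

lemma card_le_rank: "A \<in> I \<Longrightarrow> A \<subseteq> X \<Longrightarrow> card A \<le> matroid_rank I X"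
  unfolding matroid_rank_def using finite_indep_sets by (intro Max_ge) auto

lemma rank_attained:
  obtains A where "A \<in> I" "A \<subseteq> X" "card A = matroid_rank I X"
proof -
  have "matroid_rank I X \<in> {card A | A. A \<in> I \<and> A \<subseteq> X}"
    unfolding matroid_rank_def using finite_indep_sets empty_indep by (intro Max_in) auto
  then show ?thesis using that by auto
qed

lemma extend_to_rank:
  assumes "A \<in> I" "A \<subseteq> X"
  obtains B where "B \<in> I" "A \<subseteq> B" "B \<subseteq> X" "card B = matroid_rank I X"
proof -
  have "\<exists>B\<in>I. A \<subseteq> B \<and> B \<subseteq> X \<and> card B = matroid_rank I X"
    using assms
  proof (induction "matroid_rank I X - card A" arbitrary: A)
    case 0
    then show ?case using card_le_rank[of A X] by (intro bexI[of _ A]) auto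
  next
    case (Suc n)
    obtain C where C: "C \<in> I" "C \<subseteq> X" "card C = matroid_rank I X"
      by (rule rank_attained)
    obtain e where e: "e \<in> C - A" "insert e A \<in> I"
    proof -
      have "card A < card C" using Suc.hyps(2) C by linarith
      then show ?thesis using augment[OF Suc.prems(1) C(1)] that by blast
    qed
    have "card (insert e A) = Suc (card A)"
      using e finite_indep[OF Suc.prems(1)] by simp
    then have "n = matroid_rank I X - card (insert e A)" using Suc.hyps(2) by simp
    from Suc.hyps(1)[OF this] e C Suc.prems show ?case by blast
  qed
  then show ?thesis using that by blast
qed

lemma rank_mono: "X \<subseteq> Y \<Longrightarrow> matroid_rank I X \<le> matroid_rank I Y"
  by (metis card_le_rank order_trans rank_attained)

lemma rank_indep: "A \<in> I \<Longrightarrow> matroid_rank I A = card A"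
  by (metis card_le_rank card_mono finite_indep order_antisym order_refl rank_attained)

lemma rank_le_card: "finite X \<Longrightarrow> matroid_rank I X \<le> card X"
  by (metis card_mono rank_attained)

lemma rank_empty: "matroid_rank I {} = 0"
  using rank_le_card[of "{}"] by simp

lemma indep_if_card_le_rank:
  assumes "finite X" "card X \<le> matroid_rank I X"
  shows "X \<in> I"
  by (metis assms card_seteq rank_attained)

text \<open>Extending a basis of \<open>X \<inter> Y\<close> to a basis \<open>B\<close> of \<open>X \<union> Y\<close> reduces the inequality to the modular
  identity for \<open>B \<inter> X\<close> and \<open>B \<inter> Y\<close>.\<close>

lemma rank_submodular:
  "matroid_rank I (X \<union> Y) + matroid_rank I (X \<inter> Y) \<le> matroid_rank I X + matroid_rank I Y"
proof -
  obtain A where A: "A \<in> I" "A \<subseteq> X \<inter> Y" "card A = matroid_rank I (X \<inter> Y)"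
    by (rule rank_attained)
  obtain B where B: "B \<in> I" "A \<subseteq> B" "B \<subseteq> X \<union> Y" "card B = matroid_rank I (X \<union> Y)"
    using extend_to_rank[of A "X \<union> Y"] A by blast
  have "card B + card A \<le> card (B \<inter> X) + card (B \<inter> Y)"
  proof -
    have fin: "finite B" using finite_indep B by blast
    have "card (B \<inter> X) + card (B \<inter> Y) = card (B \<inter> X \<union> B \<inter> Y) + card (B \<inter> X \<inter> (B \<inter> Y))"
      using fin by (intro card_Un_Int) auto
    moreover have "B \<inter> X \<union> B \<inter> Y = B" using B by blast
    moreover have "card A \<le> card (B \<inter> X \<inter> (B \<inter> Y))"
      using A B fin by (intro card_mono) auto
    ultimately show ?thesis by simp
  qed
  also have "\<dots> \<le> matroid_rank I X + matroid_rank I Y"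
    using B indep_subset by (intro add_mono card_le_rank) blast+
  finally show ?thesis using A B by simp
qed

lemma bases_eq: "bases I = {B \<in> I. card B = matroid_rank I E}"
proof -
  have "card B = matroid_rank I E" if B: "B \<in> I" "\<forall>A\<in>I. B \<subseteq> A \<longrightarrow> A = B" for B
  proof -
    obtain C where "C \<in> I" "B \<subseteq> C" "card C = matroid_rank I E"
      using extend_to_rank[OF B(1) indep_subset_ground[OF B(1)]] by metis
    then show ?thesis using B(2) by metis
  qed
  moreover have "A = B" if B: "card B = matroid_rank I E" and A: "A \<in> I" "B \<subseteq> A" for A B
  proof -
    have "card A \<le> card B" using B card_le_rank[OF A(1) indep_subset_ground[OF A(1)]] by simp
    then show ?thesis using card_seteq[OF finite_indep[OF A(1)] A(2)] by simp
  qed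
  ultimately show ?thesis unfolding bases_def by (intro Collect_cong) metis
qed

end

section \<open>The base polytope is cut out by rank inequalities\<close>

text \<open>The inequalities of Edmonds' description. Coordinates outside the ground set are forced to \<open>0\<close>,
  so that vectors indexed by the ground set become functions on the whole type in only one way.\<close>

definition rank_polytope :: "'a set \<Rightarrow> 'a set set \<Rightarrow> ('a \<Rightarrow> real) set" where
  "rank_polytope E I = {x. (\<forall>e. e \<notin> E \<longrightarrow> x e = 0) \<and> (\<forall>e. 0 \<le> x e) \<and>
     (\<forall>A\<subseteq>E. sum x A \<le> real (matroid_rank I A)) \<and> sum x E = real (matroid_rank I E)}"

definition tight :: "'a set \<Rightarrow> 'a set set \<Rightarrow> ('a \<Rightarrow> real) \<Rightarrow> 'a set set" where
  "tight E I x = {A. A \<subseteq> E \<and> sum x A = real (matroid_rank I A)}"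

definition shift :: "('a \<Rightarrow> real) \<Rightarrow> 'a \<Rightarrow> 'a \<Rightarrow> real \<Rightarrow> 'a \<Rightarrow> real" where
  "shift x e f \<delta> = x(e := x e + \<delta>, f := x f - \<delta>)"

lemma rank_polytopeD:
  assumes "x \<in> rank_polytope E I"
  shows "e \<notin> E \<Longrightarrow> x e = 0" "0 \<le> x e"
    "A \<subseteq> E \<Longrightarrow> sum x A \<le> real (matroid_rank I A)" "sum x E = real (matroid_rank I E)"
  using assms unfolding rank_polytope_def by blast+

lemma sum_shift:
  assumes "finite A" "e \<noteq> f"
  shows "sum (shift x e f \<delta>) A = sum x A + (if e \<in> A then \<delta> else 0) - (if f \<in> A then \<delta> else 0)"
proof -
  have "shift x e f \<delta> = (\<lambda>a. x a + (if a = e then \<delta> else 0) - (if a = f then \<delta> else 0))"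
    using assms(2) by (auto simp: shift_def fun_eq_iff)
  then show ?thesis using assms(1) by (simp add: sum.distrib sum_subtractf)
qed

lemma convex_rank_polytope: "convex (rank_polytope E I)"
proof (rule convexI)
  fix x y :: "'a \<Rightarrow> real" and u v :: real
  assume x: "x \<in> rank_polytope E I" and y: "y \<in> rank_polytope E I"
    and uv: "0 \<le> u" "0 \<le> v" "u + v = 1"
  have eq: "u *\<^sub>R x + v *\<^sub>R y = (\<lambda>e. u * x e + v * y e)"
    by (simp add: scaleR_fun_def plus_fun_def)
  have sum_eq: "(\<Sum>e\<in>A. u * x e + v * y e) = u * sum x A + v * sum y A" for A
    by (simp add: sum.distrib sum_distrib_left)
  show "u *\<^sub>R x + v *\<^sub>R y \<in> rank_polytope E I"
    unfolding rank_polytope_def mem_Collect_eq eq sum_eq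
  proof (intro conjI allI impI)
    show "u * sum x A + v * sum y A \<le> real (matroid_rank I A)" if "A \<subseteq> E" for A
      using that x y uv convex_bound_le[of "sum x A" "real (matroid_rank I A)" "sum y A" u v]
      by (auto simp: rank_polytope_def)
    show "u * sum x E + v * sum y E = real (matroid_rank I E)"
      using x y uv by (simp add: rank_polytope_def flip: distrib_right)
  qed (use x y uv in \<open>auto simp: rank_polytope_def\<close>)
qed

context matroid
begin

lemma finite_subset_ground: "A \<subseteq> E \<Longrightarrow> finite A"
  using finite_ground finite_subset by blast

lemma empty_tight: "{} \<in> tight E I x"
  by (simp add: tight_def rank_empty)

lemma ground_tight: "x \<in> rank_polytope E I \<Longrightarrow> E \<in> tight E I x"
  by (simp add: tight_def rank_polytope_def)

text \<open>Submodularity of the rank against modularity of \<open>x\<close>: the slacks of \<open>A \<union> B\<close> and \<open>A \<inter> B\<close> are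
  nonnegative and add up to at most \<open>0\<close>.\<close>

lemma tight_Un_Int:
  assumes x: "x \<in> rank_polytope E I" and AB: "A \<in> tight E I x" "B \<in> tight E I x"
  shows "A \<union> B \<in> tight E I x" "A \<inter> B \<in> tight E I x"
proof -
  have sub: "A \<subseteq> E" "B \<subseteq> E" using AB by (auto simp: tight_def)
  have le: "sum x (A \<union> B) \<le> real (matroid_rank I (A \<union> B))"
    "sum x (A \<inter> B) \<le> real (matroid_rank I (A \<inter> B))"
    using sub by (auto intro!: rank_polytopeD[OF x])
  have "sum x (A \<union> B) + sum x (A \<inter> B) = sum x A + sum x B"
    using sub by (intro sum.union_inter finite_subset_ground)
  also have "\<dots> = real (matroid_rank I A + matroid_rank I B)"
    using AB by (simp add: tight_def)
  finally have "sum x (A \<union> B) + sum x (A \<inter> B)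
      \<ge> real (matroid_rank I (A \<union> B)) + real (matroid_rank I (A \<inter> B))"
    using rank_submodular[of A B] by linarith
  then show "A \<union> B \<in> tight E I x" "A \<inter> B \<in> tight E I x"
    using le sub by (auto simp: tight_def)
qed

text \<open>The inequalities that limit a move of mass from \<open>f\<close> to \<open>e\<close> are \<open>x f \<ge> 0\<close> and those of the sets
  that contain \<open>e\<close> but not \<open>f\<close>. If all of these are slack, one can move until the first of them
  becomes an equality. Convex decompositions use this maximal \<open>\<delta>\<close>; descent for the sum of squares
  uses small \<open>\<epsilon>\<close>.\<close>

lemma exchange_step:
  assumes x: "x \<in> rank_polytope E I" and ef: "e \<in> E" "f \<in> E" "e \<noteq> f" and pos: "0 < x f"
    and no_tight: "\<And>A. A \<in> tight E I x \<Longrightarrow> e \<in> A \<Longrightarrow> f \<in> A"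
  obtains \<delta> where "0 < \<delta>"
    "\<And>\<epsilon>. 0 \<le> \<epsilon> \<Longrightarrow> \<epsilon> \<le> \<delta> \<Longrightarrow> shift x e f \<epsilon> \<in> rank_polytope E I"
    "shift x e f \<delta> f = 0 \<or> (\<exists>A \<in> tight E I (shift x e f \<delta>). e \<in> A \<and> f \<notin> A)"
proof -
  define \<A> where "\<A> = {A. A \<subseteq> E \<and> e \<in> A \<and> f \<notin> A}"
  \<comment> \<open>The slacks of all inequalities that become sharper along the move.\<close>
  define S where "S = insert (x f) ((\<lambda>A. real (matroid_rank I A) - sum x A) ` \<A>)"
  define \<delta> where "\<delta> = Min S"
  have finS: "finite S" using finite_ground by (simp add: S_def \<A>_def)
  have "0 < \<delta>"
  proof -
    have "0 < real (matroid_rank I A) - sum x A" if "A \<in> \<A>" for A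
      using that rank_polytopeD(3)[OF x, of A] no_tight[of A]
      by (fastforce simp: \<A>_def tight_def)
    then show ?thesis using finS pos by (auto simp: \<delta>_def S_def)
  qed
  moreover have "shift x e f \<epsilon> \<in> rank_polytope E I" if \<epsilon>: "0 \<le> \<epsilon>" "\<epsilon> \<le> \<delta>" for \<epsilon>
  proof -
    have "\<epsilon> \<le> x f" using \<epsilon>(2) Min_le[OF finS, of "x f"] by (simp add: \<delta>_def S_def)
    moreover have "sum x A + (if e \<in> A then \<epsilon> else 0) - (if f \<in> A then \<epsilon> else 0)
        \<le> real (matroid_rank I A)" if A: "A \<subseteq> E" for A
    proof -
      have le: "sum x A \<le> real (matroid_rank I A)" using x A by (simp add: rank_polytope_def)
      have "sum x A + \<epsilon> \<le> real (matroid_rank I A)" if "e \<in> A" "f \<notin> A"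
        using \<epsilon>(2) Min_le[OF finS, of "real (matroid_rank I A) - sum x A"] that A
        by (auto simp: \<delta>_def S_def \<A>_def)
      then show ?thesis using le \<epsilon>(1) by auto
    qed
    moreover have "shift x e f \<epsilon> a = 0" if "a \<notin> E" for a
      using that x ef by (auto simp: shift_def rank_polytope_def)
    moreover have "0 \<le> shift x e f \<epsilon> a" for a
      using x \<epsilon>(1) \<open>\<epsilon> \<le> x f\<close> by (auto simp: shift_def rank_polytope_def)
    moreover have "sum x E = real (matroid_rank I E)" using x by (simp add: rank_polytope_def)
    ultimately show ?thesis
      unfolding rank_polytope_def using sum_shift[OF finite_subset_ground ef(3)] ef(1,2) by simp
  qed
  moreover have "shift x e f \<delta> f = 0 \<or> (\<exists>A \<in> tight E I (shift x e f \<delta>). e \<in> A \<and> f \<notin> A)"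
  proof -
    have "\<delta> \<in> S" unfolding \<delta>_def using finS by (intro Min_in) (auto simp: S_def)
    then consider "\<delta> = x f" | A where "A \<in> \<A>" "\<delta> = real (matroid_rank I A) - sum x A"
      by (auto simp: S_def)
    then show ?thesis
    proof cases
      case 1
      then show ?thesis by (simp add: shift_def)
    next
      case 2
      then have "A \<in> tight E I (shift x e f \<delta>)"
        using sum_shift[OF finite_subset_ground ef(3)] by (simp add: tight_def \<A>_def)
      then show ?thesis using 2 by (auto simp: \<A>_def)
    qed
  qed
  ultimately show ?thesis using that by blast
qed

lemma rank_polytope_le_1:
  assumes "x \<in> rank_polytope E I"
  shows "x e \<le> 1"
proof (cases "e \<in> E")
  case True
  then have "sum x {e} \<le> real (matroid_rank I {e})"
    by (intro rank_polytopeD(3)[OF assms]) simp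
  also have "\<dots> \<le> 1" using rank_le_card[of "{e}"] by simp
  finally show ?thesis by simp
next
  case False
  then show ?thesis using assms by (simp add: rank_polytope_def)
qed

lemma base_polytope_subset: "base_polytope I \<subseteq> rank_polytope E I"
  unfolding base_polytope_def
proof (rule hull_minimal)
  show "convex (rank_polytope E I)" by (rule convex_rank_polytope)
  show "indicator ` bases I \<subseteq> rank_polytope E I"
  proof
    fix x :: "'a \<Rightarrow> real" assume "x \<in> indicator ` bases I"
    then obtain B where B: "B \<in> I" "card B = matroid_rank I E" and x: "x = indicator B"
      unfolding bases_eq by blast
    have sum_eq: "sum x A = real (card (B \<inter> A))" if "A \<subseteq> E" for A
      using that finite_subset_ground unfolding x
      by (simp add: indicator_def sum.If_cases Int_commute)
    have "sum x A \<le> real (matroid_rank I A)" if "A \<subseteq> E" for A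
      using sum_eq[OF that] card_le_rank[of "B \<inter> A" A] indep_subset[of B "B \<inter> A"] B by simp
    moreover have "sum x E = real (matroid_rank I E)"
      using sum_eq[of E] B indep_subset_ground[of B] by (simp add: Int_absorb2)
    ultimately show "x \<in> rank_polytope E I"
      using indep_subset_ground[OF B(1)] by (auto simp: rank_polytope_def x indicator_def)
  qed
qed

lemma integral_point_is_base:
  assumes x: "x \<in> rank_polytope E I" and int: "\<And>e. x e = 0 \<or> x e = 1"
  shows "x \<in> base_polytope I"
proof -
  define B where "B = {e. x e = 1}"
  have x_eq: "x = indicator B" using int by (auto simp: B_def fun_eq_iff indicator_def)
  have sub: "B \<subseteq> E" using rank_polytopeD(1)[OF x] by (force simp: B_def)
  have "sum x B = real (card B)" by (simp add: B_def)
  moreover have "sum x E = sum x B"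
    using sub finite_ground by (intro sum.mono_neutral_right) (auto simp: x_eq)
  ultimately have "real (card B) = real (matroid_rank I E)"
    "real (card B) \<le> real (matroid_rank I B)"
    using rank_polytopeD(3)[OF x sub] rank_polytopeD(4)[OF x] by simp_all
  then have "B \<in> bases I"
    unfolding bases_eq using indep_if_card_le_rank[of B] finite_subset_ground[OF sub] by simp
  then show ?thesis unfolding base_polytope_def x_eq by (intro hull_inc imageI)
qed

text \<open>Consider a smallest tight set \<open>T\<close> that contains a fractional coordinate. As \<open>x(T)\<close> is an
  integer, \<open>T\<close> contains a second one. By minimality, a tight set that meets \<open>T\<close> in a fractional
  coordinate contains \<open>T\<close>, so tight sets cannot separate the two.\<close>

lemma fractional_pair:
  assumes x: "x \<in> rank_polytope E I" and a: "x a \<noteq> 0" "x a \<noteq> 1"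
  obtains e f where "e \<in> E" "f \<in> E" "e \<noteq> f" "0 < x e" "0 < x f"
    "\<And>A. A \<in> tight E I x \<Longrightarrow> e \<in> A \<longleftrightarrow> f \<in> A"
proof -
  define Fr where "Fr = {e. x e \<noteq> 0 \<and> x e \<noteq> 1}"
  define \<T> where "\<T> = {A \<in> tight E I x. A \<inter> Fr \<noteq> {}}"
  have "a \<in> E" using rank_polytopeD(1)[OF x] a by blast
  then have "E \<in> \<T>" using ground_tight[OF x] a by (auto simp: \<T>_def Fr_def)
  then obtain T where T: "T \<in> \<T>" and T_min: "\<And>A. A \<in> \<T> \<Longrightarrow> card T \<le> card A"
    using ex_has_least_nat[of "\<lambda>A. A \<in> \<T>" E card] by metis
  have T_tight: "T \<in> tight E I x" and T_sub: "T \<subseteq> E" and finT: "finite T"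
    using T finite_subset_ground by (auto simp: \<T>_def tight_def)
  obtain e where e: "e \<in> T" "e \<in> Fr" using T by (auto simp: \<T>_def)
  have "\<exists>f\<in>T. f \<noteq> e \<and> f \<in> Fr"
  proof (rule ccontr)
    assume "\<not> ?thesis"
    then have "x g \<in> \<int>" if "g \<in> T - {e}" for g using that by (auto simp: Fr_def)
    then have "sum x (T - {e}) \<in> \<int>" by (rule Ints_sum)
    moreover have "x e = sum x T - sum x (T - {e})"
      using e finT by (simp add: sum.remove)
    moreover have "sum x T \<in> \<int>" using T_tight by (simp add: tight_def)
    ultimately have "x e \<in> \<int>" by (metis Ints_diff)
    then obtain n where n: "x e = of_int n" by (rule Ints_cases)
    moreover have "0 \<le> x e" by (rule rank_polytopeD(2)[OF x])
    ultimately have "n = 0 \<or> n = 1" using rank_polytope_le_1[OF x, of e] by linarith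
    then show False using e n by (auto simp: Fr_def)
  qed
  then obtain f where f: "f \<in> T" "f \<noteq> e" "f \<in> Fr" by blast
  have T_le: "T \<subseteq> A" if A: "A \<in> tight E I x" and g: "g \<in> A" "g \<in> T" "g \<in> Fr" for A g
  proof -
    have "A \<inter> T \<in> \<T>" using tight_Un_Int(2)[OF x A T_tight] g by (auto simp: \<T>_def)
    then have "card T \<le> card (A \<inter> T)" by (rule T_min)
    then have "A \<inter> T = T" using finT by (intro card_seteq) auto
    then show ?thesis by blast
  qed
  show ?thesis
  proof (rule that)
    show "0 < x e" "0 < x f"
      using rank_polytopeD(2)[OF x, of e] rank_polytopeD(2)[OF x, of f] e f
      by (auto simp: Fr_def)
    show "e \<in> A \<longleftrightarrow> f \<in> A" if "A \<in> tight E I x" for A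
      using T_le[OF that, of e] T_le[OF that, of f] e f by (meson subsetD)
  qed (use e f T_sub in auto)
qed

text \<open>The hard half of Edmonds' theorem. A point with a fractional coordinate lies strictly between two
  points obtained by moving mass between an inseparable pair in both directions until a new
  equality appears. No equality is lost, so induction on the number of strict inequalities reduces
  to integral points, which are bases.\<close>

lemma rank_polytope_subset: "rank_polytope E I \<subseteq> base_polytope I"
proof
  fix x assume "x \<in> rank_polytope E I"
  then show "x \<in> base_polytope I"
  proof (induction "card (Pow E - tight E I x) + card {e \<in> E. x e \<noteq> 0}"
      arbitrary: x rule: less_induct)
    case less
    note x = less.prems
    define slack where "slack y = card (Pow E - tight E I y) + card {e \<in> E. y e \<noteq> 0}" for y
    show ?case
    proof (cases "\<forall>e. x e = 0 \<or> x e = 1")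
      case True
      then show ?thesis using integral_point_is_base[OF x] by blast
    next
      case False
      then obtain e f where ef: "e \<in> E" "f \<in> E" "e \<noteq> f" "0 < x e" "0 < x f"
        and both: "\<And>A. A \<in> tight E I x \<Longrightarrow> e \<in> A \<longleftrightarrow> f \<in> A"
        using fractional_pair[OF x] by blast
      have move: "\<exists>\<delta>>0. shift x e f \<delta> \<in> base_polytope I"
        if ef: "e \<in> E" "f \<in> E" "e \<noteq> f" "0 < x e" "0 < x f"
          and both: "\<And>A. A \<in> tight E I x \<Longrightarrow> e \<in> A \<longleftrightarrow> f \<in> A" for e f
      proof -
        obtain \<delta> where \<delta>: "0 < \<delta>" "shift x e f \<delta> \<in> rank_polytope E I"
          "shift x e f \<delta> f = 0 \<or> (\<exists>A \<in> tight E I (shift x e f \<delta>). e \<in> A \<and> f \<notin> A)"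
          using exchange_step[OF x ef(1,2,3,5)] both by (metis less_eq_real_def)
        let ?y = "shift x e f \<delta>"
        have tight_sub: "tight E I x \<subseteq> tight E I ?y"
          using both sum_shift[OF finite_subset_ground ef(3)] by (auto simp: tight_def)
        have supp_sub: "{e \<in> E. ?y e \<noteq> 0} \<subseteq> {e \<in> E. x e \<noteq> 0}"
          using ef by (auto simp: shift_def)
        have fin: "finite (Pow E - tight E I x)" "finite {e \<in> E. x e \<noteq> 0}"
          using finite_ground by auto
        have "slack ?y < slack x"
          using \<delta>(3)
        proof
          assume "?y f = 0"
          then have "{e \<in> E. ?y e \<noteq> 0} \<subset> {e \<in> E. x e \<noteq> 0}"
            using supp_sub ef by auto
          then have "card {e \<in> E. ?y e \<noteq> 0} < card {e \<in> E. x e \<noteq> 0}"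
            by (intro psubset_card_mono fin)
          moreover have "card (Pow E - tight E I ?y) \<le> card (Pow E - tight E I x)"
            using tight_sub by (intro card_mono fin) auto
          ultimately show ?thesis by (simp add: slack_def)
        next
          assume "\<exists>A \<in> tight E I ?y. e \<in> A \<and> f \<notin> A"
          then have "Pow E - tight E I ?y \<subset> Pow E - tight E I x"
            using tight_sub both unfolding tight_def by blast
          then have "card (Pow E - tight E I ?y) < card (Pow E - tight E I x)"
            by (intro psubset_card_mono fin)
          moreover have "card {e \<in> E. ?y e \<noteq> 0} \<le> card {e \<in> E. x e \<noteq> 0}"
            using supp_sub by (intro card_mono fin) auto
          ultimately show ?thesis by (simp add: slack_def)
        qed
        then have "?y \<in> base_polytope I" using less.hyps[of ?y] \<delta>(2) by (simp add: slack_def)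
        then show ?thesis using \<delta>(1) by blast
      qed
      obtain \<delta> \<gamma> where \<delta>: "0 < \<delta>" "shift x e f \<delta> \<in> base_polytope I"
        and \<gamma>: "0 < \<gamma>" "shift x f e \<gamma> \<in> base_polytope I"
        using move[OF ef both] move[OF ef(2,1) ef(3)[symmetric] ef(5,4)] both by blast
      have convex: "convex (base_polytope I)" by (simp add: base_polytope_def)
      \<comment> \<open>Weights chosen so that the two moves cancel.\<close>
      define p q where "p = \<gamma> / (\<gamma> + \<delta>)" and "q = \<delta> / (\<gamma> + \<delta>)"
      have pq: "0 \<le> p" "0 \<le> q" "p + q = 1" "p * \<delta> = q * \<gamma>"
        using \<delta>(1) \<gamma>(1) by (simp_all add: p_def q_def flip: add_divide_distrib)
      have "p *\<^sub>R shift x e f \<delta> + q *\<^sub>R shift x f e \<gamma> \<in> base_polytope I"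
        using convex \<delta>(2) \<gamma>(2) pq(1-3) by (rule convexD)
      also have "p *\<^sub>R shift x e f \<delta> + q *\<^sub>R shift x f e \<gamma> = x"
      proof
        fix a
        have "p * shift x e f \<delta> a + q * shift x f e \<gamma> a = (p + q) * x a"
          using pq(4) ef(3) by (auto simp: shift_def algebra_simps)
        then show "(p *\<^sub>R shift x e f \<delta> + q *\<^sub>R shift x f e \<gamma>) a = x a"
          using pq(3) by (simp add: scaleR_fun_def plus_fun_def)
      qed
      finally show ?thesis .
    qed
  qed
qed

theorem base_polytope_eq: "base_polytope I = rank_polytope E I"
  using base_polytope_subset rank_polytope_subset by (rule equalityI)

end

section \<open>The universal density is the point with tight lower level sets\<close>

definition tight_levels :: "'a set \<Rightarrow> 'a set set \<Rightarrow> ('a \<Rightarrow> real) \<Rightarrow> bool" where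
  "tight_levels E I x \<longleftrightarrow> (\<forall>u. {e \<in> E. x e < u} \<in> tight E I x)"

text \<open>Summation by parts over the values of \<open>x\<close>, phrased as an induction that removes the top level:
  the inequality for the rest, with the top value as its bound \<open>c\<close>, is what the step needs.\<close>

lemma sum_mult_ge_if_level_sums_nonpos:
  fixes x d :: "'a \<Rightarrow> real"
  assumes "finite S" "\<And>e. e \<in> S \<Longrightarrow> x e \<le> c" "\<And>u. sum d {e \<in> S. x e < u} \<le> 0"
  shows "c * sum d S \<le> (\<Sum>e\<in>S. x e * d e)"
  using assms
proof (induction "card S" arbitrary: S c rule: less_induct)
  case less
  show ?case
  proof (cases "S = {}")
    case False
    define m where "m = Max (x ` S)"
    define L where "L = {e \<in> S. x e < m}"
    have le_m: "x e \<le> m" if "e \<in> S" for e using that less.prems(1) by (simp add: m_def)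
    have m_in: "m \<in> x ` S" unfolding m_def using False less.prems(1) by (intro Max_in) auto
    have finL: "finite L" and LS: "L \<subseteq> S" using less.prems(1) by (auto simp: L_def)
    have "L \<noteq> S" using m_in by (auto simp: L_def)
    then have "card L < card S" using LS less.prems(1) by (intro psubset_card_mono) auto
    moreover have "sum d {e \<in> L. x e < u} \<le> 0" for u
    proof -
      have "{e \<in> L. x e < u} = {e \<in> S. x e < min u m}" by (auto simp: L_def)
      then show ?thesis using less.prems(3) by metis
    qed
    moreover have "x e \<le> m" if "e \<in> L" for e using that by (simp add: L_def)
    ultimately have IH: "m * sum d L \<le> (\<Sum>e\<in>L. x e * d e)"
      using less.hyps[of L m] finL by blast
    have "{e \<in> S. x e < m + 1} = S" using le_m by force
    then have "sum d S \<le> 0" using less.prems(3)[of "m + 1"] by simp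
    moreover have "m \<le> c" using m_in less.prems(2) by auto
    ultimately have "c * sum d S \<le> m * sum d S" by (intro mult_right_mono_neg)
    also have "\<dots> = m * sum d L + m * sum d (S - L)"
      using sum.subset_diff[OF LS less.prems(1), of d] by (simp add: algebra_simps)
    also have "m * sum d (S - L) = (\<Sum>e\<in>S - L. x e * d e)"
      using le_m by (force simp: sum_distrib_left L_def intro: sum.cong)
    also have "m * sum d L + (\<Sum>e\<in>S - L. x e * d e) \<le> (\<Sum>e\<in>S. x e * d e)"
      using IH sum.subset_diff[OF LS less.prems(1), of "\<lambda>e. x e * d e"] by simp
    finally show ?thesis .
  qed simp
qed

text \<open>\<open>L\<close> is the union over \<open>e \<in> L\<close> of the intersections over \<open>f \<notin> L\<close> of members that separate \<open>e\<close>
  from \<open>f\<close>.\<close>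

lemma separated_set_in_lattice:
  assumes fin: "finite E" and L: "L \<subseteq> E" and empty: "{} \<in> F" and ground: "E \<in> F"
    and Un: "\<And>A B. A \<in> F \<Longrightarrow> B \<in> F \<Longrightarrow> A \<union> B \<in> F"
    and Int: "\<And>A B. A \<in> F \<Longrightarrow> B \<in> F \<Longrightarrow> A \<inter> B \<in> F"
    and sub: "\<And>A. A \<in> F \<Longrightarrow> A \<subseteq> E"
    and sep: "\<And>e f. e \<in> L \<Longrightarrow> f \<in> E - L \<Longrightarrow> \<exists>A\<in>F. e \<in> A \<and> f \<notin> A"
  shows "L \<in> F"
proof -
  have Int_sep: "\<exists>A\<in>F. e \<in> A \<and> A \<inter> D = {}" if "finite D" "D \<subseteq> E - L" "e \<in> L" for e D
    using that
  proof (induction D)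
    case empty
    then show ?case using ground L by blast
  next
    case (insert f D)
    then obtain A where "A \<in> F" "e \<in> A" "A \<inter> D = {}" by blast
    moreover obtain B where "B \<in> F" "e \<in> B" "f \<notin> B" using sep[of e f] insert.prems by blast
    ultimately have "A \<inter> B \<in> F" "e \<in> A \<inter> B" "A \<inter> B \<inter> insert f D = {}" using Int by auto
    then show ?case by metis
  qed
  have nbhd: "\<exists>A\<in>F. e \<in> A \<and> A \<subseteq> L" if "e \<in> L" for e
    using Int_sep[of "E - L" e] that fin sub by blast
  have "\<exists>A\<in>F. D \<subseteq> A \<and> A \<subseteq> L" if "finite D" "D \<subseteq> L" for D
    using that
  proof (induction D)
    case empty
    show ?case using \<open>{} \<in> F\<close> by (intro bexI[of _ "{}"]) auto
  next
    case (insert e D)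
    then obtain A where "A \<in> F" "D \<subseteq> A" "A \<subseteq> L" by blast
    moreover have "e \<in> L" using insert.prems by simp
    from nbhd[OF this] obtain B where "B \<in> F" "e \<in> B" "B \<subseteq> L" by blast
    ultimately have "A \<union> B \<in> F" "insert e D \<subseteq> A \<union> B" "A \<union> B \<subseteq> L" using Un by auto
    then show ?case by metis
  qed
  from this[of L] show ?thesis using finite_subset[OF L fin] by (metis order_refl subset_antisym)
qed

context matroid
begin

text \<open>With \<open>d = y - x\<close> one has \<open>\<Sum>y\<^sup>2 = \<Sum>x\<^sup>2 + 2\<Sum>x d + \<Sum>d\<^sup>2\<close>. Tightness of the lower level sets of \<open>x\<close>
  means that \<open>d\<close> has nonpositive sum on each of them, so the cross term is nonnegative. The
  quadratic remainder yields uniqueness as well as minimality.\<close>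

lemma tight_levels_strict_minimum:
  assumes x: "x \<in> rank_polytope E I" "tight_levels E I x" and y: "y \<in> rank_polytope E I"
  shows "(\<Sum>e\<in>E. (x e)\<^sup>2) + (\<Sum>e\<in>E. (y e - x e)\<^sup>2) \<le> (\<Sum>e\<in>E. (y e)\<^sup>2)"
proof -
  let ?d = "\<lambda>e. y e - x e"
  have "sum ?d {e \<in> E. x e < u} \<le> 0" for u
  proof -
    have "sum x {e \<in> E. x e < u} = real (matroid_rank I {e \<in> E. x e < u})"
      using x(2) by (simp add: tight_levels_def tight_def)
    then show ?thesis using rank_polytopeD(3)[OF y, of "{e \<in> E. x e < u}"]
      by (simp add: sum_subtractf)
  qed
  then have "1 * sum ?d E \<le> (\<Sum>e\<in>E. x e * ?d e)"
    using rank_polytope_le_1[OF x(1)] finite_ground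
    by (intro sum_mult_ge_if_level_sums_nonpos)
  moreover have "sum ?d E = 0"
    using rank_polytopeD(4)[OF x(1)] rank_polytopeD(4)[OF y] by (simp add: sum_subtractf)
  ultimately have "0 \<le> 2 * (\<Sum>e\<in>E. x e * ?d e)" by simp
  also have "\<dots> = (\<Sum>e\<in>E. (y e)\<^sup>2) - (\<Sum>e\<in>E. (x e)\<^sup>2) - (\<Sum>e\<in>E. (?d e)\<^sup>2)"
    unfolding sum_distrib_left sum_subtractf[symmetric]
    by (intro sum.cong) (auto simp: power2_eq_square algebra_simps)
  finally show ?thesis by simp
qed

lemma universal_density_eqI:
  assumes "x \<in> rank_polytope E I" "tight_levels E I x"
  shows "universal_density E I = x"
  unfolding universal_density_def base_polytope_eq
proof (rule the_equality)
  have "(\<Sum>e\<in>E. (x e)\<^sup>2) \<le> (\<Sum>e\<in>E. (y e)\<^sup>2)" if "y \<in> rank_polytope E I" for y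
  proof -
    have "0 \<le> (\<Sum>e\<in>E. (y e - x e)\<^sup>2)" by (intro sum_nonneg) simp
    then show ?thesis using tight_levels_strict_minimum[OF assms that] by linarith
  qed
  then show "x \<in> rank_polytope E I \<and>
      (\<forall>y\<in>rank_polytope E I. (\<Sum>e\<in>E. (x e)\<^sup>2) \<le> (\<Sum>e\<in>E. (y e)\<^sup>2))"
    using assms(1) by blast
next
  fix z assume z: "z \<in> rank_polytope E I \<and>
      (\<forall>y\<in>rank_polytope E I. (\<Sum>e\<in>E. (z e)\<^sup>2) \<le> (\<Sum>e\<in>E. (y e)\<^sup>2))"
  then have "(\<Sum>e\<in>E. (z e - x e)\<^sup>2) \<le> 0"
    using tight_levels_strict_minimum[OF assms, of z] bspec[of _ _ x] assms(1)
    by (metis (no_types, lifting) add_le_same_cancel1 order_trans)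
  then have "(\<Sum>e\<in>E. (z e - x e)\<^sup>2) = 0" by (intro antisym sum_nonneg) auto
  then have "\<forall>e\<in>E. (z e - x e)\<^sup>2 = 0"
    by (subst (asm) sum_nonneg_eq_0_iff) (use finite_ground in auto)
  then have "z e = x e" if "e \<in> E" for e using that by simp
  moreover have "z e = x e" if "e \<notin> E" for e
    using that z assms(1) rank_polytopeD(1) by metis
  ultimately show "z = x" by blast
qed

lemma rank_polytope_nonempty: "rank_polytope E I \<noteq> {}"
proof -
  obtain B where "B \<in> I" "card B = matroid_rank I E" by (rule rank_attained)
  then have "indicator B \<in> base_polytope I"
    unfolding base_polytope_def bases_eq by (intro hull_inc) blast
  then show ?thesis using base_polytope_eq by blast
qed

text \<open>Compactness gives the existence of a minimizer. The vectors are functions on a possibly infinite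
  type, so it comes from Tychonoff's theorem in the product topology.\<close>

lemma compact_rank_polytope: "compact (rank_polytope E I)"
proof -
  let ?box = "PiE UNIV (\<lambda>e. if e \<in> E then {0..1} else {0::real})"
  have "compactin (product_topology (\<lambda>_. euclidean) UNIV) ?box"
    by (simp add: compactin_PiE)
  then have "compact ?box" by (simp add: euclidean_product_topology)
  moreover have "closed {x :: 'a \<Rightarrow> real. \<forall>A\<subseteq>E. sum x A \<le> real (matroid_rank I A)}"
    by (intro closed_Collect_all closed_Collect_imp closed_Collect_le continuous_intros)
      (auto intro: continuous_on_product_coordinates)
  moreover have "closed {x :: 'a \<Rightarrow> real. sum x E = real (matroid_rank I E)}"
    by (intro closed_Collect_eq continuous_intros) (auto intro: continuous_on_product_coordinates)
  ultimately have "compact (?box \<inter> ({x. \<forall>A\<subseteq>E. sum x A \<le> real (matroid_rank I A)}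
      \<inter> {x. sum x E = real (matroid_rank I E)}))"
    by (intro compact_Int_closed closed_Int)
  also have "?box \<inter> ({x. \<forall>A\<subseteq>E. sum x A \<le> real (matroid_rank I A)}
      \<inter> {x. sum x E = real (matroid_rank I E)}) = rank_polytope E I"
    (is "?L = _")
  proof (intro subset_antisym subsetI)
    fix x assume x: "x \<in> ?L"
    from x have "x \<in> ?box" by (rule IntD1)
    then have box: "x e \<in> (if e \<in> E then {0..1} else {0})" for e by (rule PiE_mem) simp
    have "0 \<le> x e" "e \<notin> E \<Longrightarrow> x e = 0" for e using box[of e] by (auto split: if_splits)
    moreover have "\<forall>A\<subseteq>E. sum x A \<le> real (matroid_rank I A)" "sum x E = real (matroid_rank I E)"
      using IntD2[OF x] by simp_all
    ultimately show "x \<in> rank_polytope E I" by (simp add: rank_polytope_def)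
  next
    fix x assume x: "x \<in> rank_polytope E I"
    have "x \<in> ?box"
      using rank_polytopeD(1,2)[OF x] rank_polytope_le_1[OF x] by (intro PiE_I) simp_all
    then show "x \<in> ?L" using rank_polytopeD(3,4)[OF x] by (intro IntI) simp_all
  qed
  finally show ?thesis .
qed

text \<open>If no tight set separated \<open>e\<close> from \<open>f\<close> although \<open>x e < x f\<close>, moving a little mass from \<open>f\<close> to \<open>e\<close>
  would stay in the polytope and lower the sum of squares. Hence tight sets separate each lower
  level set from its complement, and tight sets form a lattice.\<close>

lemma minimizer_tight_levels:
  assumes x: "x \<in> rank_polytope E I"
    and min: "\<And>y. y \<in> rank_polytope E I \<Longrightarrow> (\<Sum>e\<in>E. (x e)\<^sup>2) \<le> (\<Sum>e\<in>E. (y e)\<^sup>2)"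
  shows "tight_levels E I x"
  unfolding tight_levels_def
proof
  fix u
  show "{e \<in> E. x e < u} \<in> tight E I x"
  proof (rule separated_set_in_lattice[where E = E])
    fix e f assume "e \<in> {e \<in> E. x e < u}" and "f \<in> E - {e \<in> E. x e < u}"
    then have ef: "e \<in> E" "f \<in> E" "x e < x f" "e \<noteq> f" by auto
    have pos: "0 < x f" using rank_polytopeD(2)[OF x, of e] ef by simp
    show "\<exists>A\<in>tight E I x. e \<in> A \<and> f \<notin> A"
    proof (rule ccontr)
      assume "\<not> ?thesis"
      then obtain \<delta> where \<delta>: "0 < \<delta>"
        "\<And>\<epsilon>. 0 \<le> \<epsilon> \<Longrightarrow> \<epsilon> \<le> \<delta> \<Longrightarrow> shift x e f \<epsilon> \<in> rank_polytope E I"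
        using exchange_step[OF x ef(1,2,4) pos] by metis
      \<comment> \<open>Moving less than the whole gap \<open>x f - x e\<close> lowers the sum of squares strictly.\<close>
      define \<epsilon> where "\<epsilon> = min \<delta> ((x f - x e) / 2)"
      have \<epsilon>: "0 < \<epsilon>" "\<epsilon> \<le> \<delta>" "\<epsilon> < x f - x e" using \<delta>(1) ef(3) by (auto simp: \<epsilon>_def min_def)
      have split: "(\<Sum>a\<in>E. (z a)\<^sup>2) = (z e)\<^sup>2 + (z f)\<^sup>2 + (\<Sum>a\<in>E - {e, f}. (z a)\<^sup>2)"
        for z :: "'a \<Rightarrow> real"
        using sum.subset_diff[of "{e, f}" E "\<lambda>a. (z a)\<^sup>2"] ef finite_ground by simp
      have "(\<Sum>a\<in>E - {e, f}. (shift x e f \<epsilon> a)\<^sup>2) = (\<Sum>a\<in>E - {e, f}. (x a)\<^sup>2)"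
        by (intro sum.cong) (auto simp: shift_def)
      then have "(\<Sum>a\<in>E. (shift x e f \<epsilon> a)\<^sup>2) - (\<Sum>a\<in>E. (x a)\<^sup>2)
          = (x e + \<epsilon>)\<^sup>2 + (x f - \<epsilon>)\<^sup>2 - (x e)\<^sup>2 - (x f)\<^sup>2"
        unfolding split using ef(4) by (simp add: shift_def)
      also have "\<dots> = - (2 * \<epsilon> * (x f - x e - \<epsilon>))"
        by (simp add: power2_eq_square algebra_simps)
      also have "\<dots> < 0" using \<epsilon> by simp
      finally show False using min[OF \<delta>(2)[of \<epsilon>]] \<epsilon> by simp
    qed
  qed (use finite_ground empty_tight ground_tight[OF x] tight_Un_Int[OF x] in \<open>auto simp: tight_def\<close>)
qed

theorem universal_density_tight_levels:
  shows universal_density_in: "universal_density E I \<in> rank_polytope E I"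
    and universal_density_levels: "tight_levels E I (universal_density E I)"
proof -
  have "continuous_on (rank_polytope E I) (\<lambda>x. \<Sum>e\<in>E. (x e)\<^sup>2)"
    by (intro continuous_intros continuous_on_subset[OF continuous_on_product_coordinates]) simp
  then obtain x where x: "x \<in> rank_polytope E I"
      "\<And>y. y \<in> rank_polytope E I \<Longrightarrow> (\<Sum>e\<in>E. (x e)\<^sup>2) \<le> (\<Sum>e\<in>E. (y e)\<^sup>2)"
    using continuous_attains_inf[OF compact_rank_polytope rank_polytope_nonempty] by blast
  have lev: "tight_levels E I x" by (rule minimizer_tight_levels[OF x])
  then have "universal_density E I = x" by (intro universal_density_eqI x)
  then show "universal_density E I \<in> rank_polytope E I" "tight_levels E I (universal_density E I)"
    using x lev by simp_all
qed

end

section \<open>Truncation\<close>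

context matroid
begin

lemma matroid_truncation: "matroid E (truncation t I)"
proof
  fix A B assume A: "A \<in> truncation t I" and B: "B \<in> truncation t I" and less: "card A < card B"
  then obtain e where e: "e \<in> B - A" "insert e A \<in> I"
    using augment[of A B] by (auto simp: truncation_def)
  moreover have "card (insert e A) \<le> t"
    using e(1) B less finite_indep[of A] A by (simp add: truncation_def)
  ultimately show "\<exists>e\<in>B - A. insert e A \<in> truncation t I" by (auto simp: truncation_def)
next
  fix A B assume "A \<in> truncation t I" "B \<subseteq> A"
  then show "B \<in> truncation t I"
    using indep_subset[of A B] finite_indep[of A] card_mono[of A B] by (simp add: truncation_def)
qed (use finite_ground indep_subset_ground empty_indep in \<open>auto simp: truncation_def\<close>)

lemma rank_truncation: "matroid_rank (truncation t I) X = min t (matroid_rank I X)"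
proof (rule antisym)
  interpret T: matroid E "truncation t I" by (rule matroid_truncation)
  obtain A where "A \<in> truncation t I" "A \<subseteq> X" "card A = matroid_rank (truncation t I) X"
    by (rule T.rank_attained)
  then show "matroid_rank (truncation t I) X \<le> min t (matroid_rank I X)"
    using card_le_rank[of A X] by (simp add: truncation_def)
  obtain B where B: "B \<in> I" "B \<subseteq> X" "card B = matroid_rank I X" by (rule rank_attained)
  obtain C where C: "C \<subseteq> B" "card C = min t (matroid_rank I X)"
    using obtain_subset_with_card_n[of "min t (matroid_rank I X)" B] B(3) by auto
  then have "C \<in> truncation t I" using indep_subset[OF B(1)] by (simp add: truncation_def)
  then show "min t (matroid_rank I X) \<le> matroid_rank (truncation t I) X"
    using T.card_le_rank[of C X] B(2) C by simp
qed

text \<open>Capping at \<open>u\<close> leaves the level sets up to height \<open>u\<close> unchanged, together with the mass on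
  them. They stay tight because their rank is at most \<open>t\<close> and is not affected by the truncation;
  every higher level set is the whole ground set.\<close>

theorem universal_density_truncation:
  assumes u: "0 \<le> u" and total: "(\<Sum>e\<in>E. min (universal_density E I e) u) = real t"
  shows "universal_density E (truncation t I) = (\<lambda>e. min (universal_density E I e) u)"
proof -
  interpret T: matroid E "truncation t I" by (rule matroid_truncation)
  let ?x = "universal_density E I"
  let ?y = "\<lambda>e. min (?x e) u"
  note x = rank_polytopeD[OF universal_density_in]
  have y_le_rank: "sum ?y A \<le> real (matroid_rank I A)" if "A \<subseteq> E" for A
    using sum_mono[of A ?y ?x] x(3)[OF that] by simp
  have y_le_t: "sum ?y A \<le> real t" if "A \<subseteq> E" for A
    using sum_mono2[OF finite_ground that, of ?y] x(2) u total by simp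
  have t_le: "t \<le> matroid_rank I E" using y_le_rank[of E] total by simp
  show ?thesis
  proof (rule T.universal_density_eqI)
    show "?y \<in> rank_polytope E (truncation t I)"
      unfolding rank_polytope_def rank_truncation of_nat_min
      using x(1,2) u total y_le_rank y_le_t t_le by simp
    show "tight_levels E (truncation t I) ?y"
      unfolding tight_levels_def
    proof
      fix v
      show "{e \<in> E. ?y e < v} \<in> tight E (truncation t I) ?y"
      proof (cases "v \<le> u")
        case True
        let ?L = "{e \<in> E. ?x e < v}"
        have "sum ?y ?L = sum ?x ?L" using True by (intro sum.cong) auto
        also have "\<dots> = real (matroid_rank I ?L)"
          using universal_density_levels by (simp add: tight_levels_def tight_def)
        finally have L: "sum ?y ?L = real (matroid_rank I ?L)" .
        then have "matroid_rank I ?L \<le> t" using y_le_t[of ?L] by simp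
        then have "?L \<in> tight E (truncation t I) ?y"
          using L by (simp add: tight_def rank_truncation min_absorb2)
        moreover have "{e \<in> E. ?y e < v} = ?L" using True by auto
        ultimately show ?thesis by simp
      next
        case False
        then have "{e \<in> E. ?y e < v} = E" by auto
        then show ?thesis using total t_le by (simp add: tight_def rank_truncation min_absorb1)
      qed
    qed
  qed
qed

end

section \<open>Contraction\<close>

context matroid
begin

text \<open>A basis \<open>J\<close> of \<open>X\<close> cannot grow inside \<open>X\<close>, so extending it to a basis of \<open>X \<union> Y\<close> only adds
  elements outside \<open>X\<close>. This turns questions about \<open>M/X\<close> into questions about independent sets
  containing \<open>J\<close>.\<close>

lemma extend_over_basis:
  assumes J: "J \<in> I" "J \<subseteq> X" "card J = matroid_rank I X"
  obtains K where "K \<in> I" "K \<subseteq> X \<union> Y" "K \<inter> X = J" "card K = matroid_rank I (X \<union> Y)"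
proof -
  obtain K where K: "K \<in> I" "J \<subseteq> K" "K \<subseteq> X \<union> Y" "card K = matroid_rank I (X \<union> Y)"
    using extend_to_rank[of J "X \<union> Y"] J by blast
  have KX: "K \<inter> X \<in> I" using indep_subset[OF K(1)] by simp
  then have "card (K \<inter> X) \<le> card J" using card_le_rank[of "K \<inter> X" X] J(3) by simp
  then have "J = K \<inter> X" using K(2) J(2) finite_indep[OF KX] by (intro card_seteq) auto
  then show ?thesis using that K by blast
qed

lemma contraction_indep_iff:
  assumes J: "J \<in> I" "J \<subseteq> X" "card J = matroid_rank I X" and Y: "Y \<subseteq> E - X"
  shows "Y \<in> contraction E I X \<longleftrightarrow> J \<union> Y \<in> I"
proof -
  obtain K where K: "K \<in> I" "K \<subseteq> X \<union> Y" "K \<inter> X = J" "card K = matroid_rank I (X \<union> Y)"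
    using extend_over_basis[OF J] .
  have "matroid_rank I (X \<union> Y) \<le> matroid_rank I (J \<union> Y)"
    using card_le_rank[of K "J \<union> Y"] K by force
  moreover have "matroid_rank I (J \<union> Y) \<le> matroid_rank I (X \<union> Y)"
    using J(2) by (intro rank_mono) auto
  moreover have fin: "finite (J \<union> Y)"
    using finite_indep[OF J(1)] finite_subset[OF Y] finite_ground by simp
  moreover have "card (J \<union> Y) = card J + card Y"
    using fin J(2) Y by (intro card_Un_disjoint) auto
  ultimately show ?thesis
    using Y J(3) rank_indep[of "J \<union> Y"] indep_if_card_le_rank[of "J \<union> Y"]
    by (auto simp: contraction_def)
qed

lemma matroid_contraction: "matroid (E - X) (contraction E I X)"
proof -
  obtain J where J: "J \<in> I" "J \<subseteq> X" "card J = matroid_rank I X" by (rule rank_attained)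
  note iff = contraction_indep_iff[OF J]
  show ?thesis
  proof
    show sub: "A \<subseteq> E - X" if "A \<in> contraction E I X" for A using that by (simp add: contraction_def)
    show "B \<in> contraction E I X" if "A \<in> contraction E I X" "B \<subseteq> A" for A B
    proof -
      have "J \<union> A \<in> I" using sub[OF that(1)] that(1) iff by blast
      then have "J \<union> B \<in> I" by (rule indep_subset) (use that(2) in auto)
      then show ?thesis using sub[OF that(1)] that(2) iff by blast
    qed
    show "\<exists>e\<in>B - A. insert e A \<in> contraction E I X"
      if AB: "A \<in> contraction E I X" "B \<in> contraction E I X" "card A < card B" for A B
    proof -
      have fin: "finite J" "finite A" "finite B"
        using finite_indep[OF J(1)] sub[OF AB(1)] sub[OF AB(2)] finite_ground
        by (auto intro: finite_subset)
      have indep: "J \<union> A \<in> I" "J \<union> B \<in> I" using sub AB(1,2) iff by blast+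
      have "card (J \<union> A) = card J + card A" "card (J \<union> B) = card J + card B"
        using fin J(2) sub[OF AB(1)] sub[OF AB(2)] by (auto intro!: card_Un_disjoint)
      then obtain e where e: "e \<in> J \<union> B - (J \<union> A)" "insert e (J \<union> A) \<in> I"
        using augment[OF indep] AB(3) by auto
      then have "insert e A \<subseteq> E - X" "J \<union> insert e A \<in> I"
        using sub[OF AB(1)] sub[OF AB(2)] by auto
      then have "insert e A \<in> contraction E I X" using iff by blast
      then show ?thesis using e(1) by blast
    qed
  qed (use finite_ground in \<open>simp_all add: contraction_def\<close>)
qed

lemma rank_contraction:
  assumes "Y \<subseteq> E - X"
  shows "matroid_rank (contraction E I X) Y + matroid_rank I X = matroid_rank I (X \<union> Y)"
proof (rule antisym)
  interpret C: matroid "E - X" "contraction E I X" by (rule matroid_contraction)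
  obtain A where "A \<in> contraction E I X" and \<open>A \<subseteq> Y\<close> and "card A = matroid_rank (contraction E I X) Y"
    by (rule C.rank_attained)
  moreover from this have "matroid_rank I (X \<union> A) = matroid_rank I X + card A"
    unfolding contraction_def by blast
  moreover have "matroid_rank I (X \<union> A) \<le> matroid_rank I (X \<union> Y)"
    using \<open>A \<subseteq> Y\<close> by (intro rank_mono) auto
  ultimately show "matroid_rank (contraction E I X) Y + matroid_rank I X \<le> matroid_rank I (X \<union> Y)"
    by simp
  obtain J where J: "J \<in> I" "J \<subseteq> X" "card J = matroid_rank I X" by (rule rank_attained)
  obtain K where K: "K \<in> I" "K \<subseteq> X \<union> Y" "K \<inter> X = J" "card K = matroid_rank I (X \<union> Y)"
    using extend_over_basis[OF J] .
  have "J \<union> (K - X) = K" using K(3) by auto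
  moreover have "K - X \<subseteq> E - X" "K - X \<subseteq> Y" using K(2) assms by auto
  ultimately have "card (K - X) \<le> matroid_rank (contraction E I X) Y"
    using contraction_indep_iff[OF J, of "K - X"] C.card_le_rank[of "K - X" Y] K(1) by simp
  moreover have "card K = card J + card (K - X)"
    using card_Int_Diff[OF finite_indep[OF K(1)], of X] K(3) by simp
  ultimately show "matroid_rank I (X \<union> Y) \<le> matroid_rank (contraction E I X) Y + matroid_rank I X"
    using J(3) K(4) by simp
qed

text \<open>As \<open>X\<close> is tight, \<open>\<eta>*(X \<union> A) = r(X) + \<eta>*(A)\<close>. So the rank inequality of \<open>A\<close> in \<open>M/X\<close> is that of
  \<open>X \<union> A\<close> in \<open>M\<close>, one is an equality if and only if the other is, and each level set of the
  restriction becomes a level set of \<open>\<eta>*\<close> when \<open>X\<close> is added.\<close>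

theorem universal_density_contraction:
  fixes u :: real
  defines "X \<equiv> {e \<in> E. universal_density E I e < u}"
  shows "universal_density (E - X) (contraction E I X)
    = (\<lambda>e. if e \<in> X then 0 else universal_density E I e)"
proof -
  interpret C: matroid "E - X" "contraction E I X" by (rule matroid_contraction)
  let ?x = "universal_density E I"
  let ?y = "\<lambda>e. if e \<in> X then 0 else ?x e"
  note x = rank_polytopeD[OF universal_density_in]
  have levels: "sum ?x {e \<in> E. ?x e < v} = real (matroid_rank I {e \<in> E. ?x e < v})" for v
    using universal_density_levels by (simp add: tight_levels_def tight_def)
  have XE: "X \<subseteq> E" by (auto simp: X_def)
  have sum_y: "sum ?y A + real (matroid_rank I X) = sum ?x (X \<union> A)" if A: "A \<subseteq> E - X" for A
  proof -
    have "sum ?y A = sum ?x A" using A by (intro sum.cong) auto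
    moreover have "sum ?x (X \<union> A) = sum ?x X + sum ?x A"
      using A XE finite_subset[OF _ finite_ground] by (intro sum.union_disjoint) auto
    ultimately show ?thesis using levels[of u] by (simp add: X_def)
  qed
  have tight_iff: "sum ?y A = real (matroid_rank (contraction E I X) A)
      \<longleftrightarrow> sum ?x (X \<union> A) = real (matroid_rank I (X \<union> A))" if "A \<subseteq> E - X" for A
    using sum_y[OF that] rank_contraction[OF that] by linarith
  show ?thesis
  proof (rule C.universal_density_eqI)
    have "sum ?y A \<le> real (matroid_rank (contraction E I X) A)" if A: "A \<subseteq> E - X" for A
    proof -
      have "X \<union> A \<subseteq> E" using A XE by auto
      then show ?thesis using sum_y[OF A] rank_contraction[OF A] x(3)[of "X \<union> A"] by linarith
    qed
    moreover have "sum ?y (E - X) = real (matroid_rank (contraction E I X) (E - X))"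
      using tight_iff[of "E - X"] x(4) XE by (simp add: Un_absorb1)
    ultimately show "?y \<in> rank_polytope (E - X) (contraction E I X)"
      unfolding rank_polytope_def using x(1,2) by auto
    show "tight_levels (E - X) (contraction E I X) ?y"
      unfolding tight_levels_def
    proof
      fix v
      let ?L = "{e \<in> E - X. ?y e < v}"
      have "X \<union> ?L = {e \<in> E. ?x e < max u v}" by (auto simp: X_def)
      then have "sum ?x (X \<union> ?L) = real (matroid_rank I (X \<union> ?L))" using levels by metis
      moreover have "?L \<subseteq> E - X" by blast
      ultimately show "?L \<in> tight (E - X) (contraction E I X) ?y"
        unfolding tight_def mem_Collect_eq using tight_iff[of ?L] by blast
    qed
  qed
qed

end

section \<open>Balancity\<close>

context loopless_matroid
begin

lemma rank_pos: "e \<in> E \<Longrightarrow> e \<in> X \<Longrightarrow> 0 < matroid_rank I X"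
  using card_le_rank[OF loopless, of e X] by simp

lemma ground_nonempty: "E \<noteq> {}"
  using positive_rank rank_empty by auto

text \<open>The set \<open>A\<close> where the density is smallest is itself a strict lower level set, hence tight.
  Since a loopless matroid gives it positive rank, the smallest density is positive.\<close>

lemma minimal_density_level:
  assumes m: "m \<in> universal_density E I ` E" "\<And>e. e \<in> E \<Longrightarrow> m \<le> universal_density E I e"
  defines "A \<equiv> {e \<in> E. universal_density E I e = m}"
  shows "m * real (card A) = real (matroid_rank I A)" "0 < card A" "0 < matroid_rank I A" "0 < m"
proof -
  let ?x = "universal_density E I"
  \<comment> \<open>No density value lies strictly between \<open>m\<close> and \<open>v\<close>; the entry \<open>m + 1\<close> covers a constant density.\<close>
  define v where "v = Min (insert (m + 1) (?x ` {e \<in> E. m < ?x e}))"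
  have "m < v" using finite_ground by (simp add: v_def)
  have "v \<le> ?x e" if "e \<in> E" "m < ?x e" for e
    unfolding v_def using finite_ground that by (intro Min_le) auto
  then have A_eq: "A = {e \<in> E. ?x e < v}"
    using \<open>m < v\<close> m(2) by (force simp: A_def)
  have "sum ?x A = real (matroid_rank I A)"
    unfolding A_eq using universal_density_levels by (simp add: tight_levels_def tight_def)
  moreover have "sum ?x A = m * real (card A)" by (simp add: A_def)
  ultimately show eq: "m * real (card A) = real (matroid_rank I A)" by simp
  obtain e where e: "e \<in> E" "e \<in> A" using m(1) by (auto simp: A_def)
  show pos: "0 < matroid_rank I A" using rank_pos[OF e] .
  show "0 < card A" using e(2) finite_ground by (auto simp: card_gt_0_iff A_def)
  show "0 < m" using eq pos by (smt (verit) mult_nonpos_nonneg of_nat_0_le_iff of_nat_0_less_iff)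
qed

lemma universal_density_pos:
  assumes "e \<in> E"
  shows "0 < universal_density E I e"
proof -
  define m where "m = Min (universal_density E I ` E)"
  have "m \<in> universal_density E I ` E" unfolding m_def
    using finite_ground ground_nonempty by (intro Min_in) auto
  moreover have le: "m \<le> universal_density E I a" if "a \<in> E" for a
    using that finite_ground by (simp add: m_def)
  ultimately have "0 < m" by (rule minimal_density_level)
  then show ?thesis using le[OF assms] by simp
qed

text \<open>If \<open>t\<close> is small enough, capping the density at \<open>t / |E|\<close> flattens it completely. Conversely, the
  rank inequality of the tight set where the density equals \<open>m\<close> bounds every constant vector in
  the base polytope of the truncation by \<open>m\<close>.\<close>

lemma homogeneous_truncation_iff:
  assumes m: "m \<in> universal_density E I ` E" "\<And>e. e \<in> E \<Longrightarrow> m \<le> universal_density E I e"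
    and t: "t \<le> matroid_rank I E"
  shows "homogeneous E (truncation t I) \<longleftrightarrow> real t \<le> real (card E) * m"
proof
  interpret T: matroid E "truncation t I" by (rule matroid_truncation)
  let ?y = "universal_density E (truncation t I)"
  note y = rank_polytopeD[OF T.universal_density_in]
  have cardE: "0 < card E" using ground_nonempty finite_ground by (simp add: card_gt_0_iff)
  {
    assume "homogeneous E (truncation t I)"
    then obtain a where a: "\<And>e. e \<in> E \<Longrightarrow> ?y e = a"
      unfolding homogeneous_def constant_on_def by blast
    define A where "A = {e \<in> E. universal_density E I e = m}"
    note A = minimal_density_level[OF m, folded A_def]
    have AE: "A \<subseteq> E" by (auto simp: A_def)
    have "real (card E) * a = real t" using y(4) a t by (simp add: rank_truncation min_absorb1)
    moreover have "real (card A) * a \<le> real (card A) * m"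
    proof -
      have "real (card A) * a = sum ?y A" using a AE by (simp add: subset_iff)
      also have "\<dots> \<le> real (min t (matroid_rank I A))" using y(3)[OF AE] by (simp add: rank_truncation)
      also have "\<dots> \<le> real (card A) * m" using A(1) by (simp add: mult.commute)
      finally show ?thesis .
    qed
    then have "a \<le> m" using A(2) by simp
    ultimately show "real t \<le> real (card E) * m" using mult_left_mono[of a m "real (card E)"] by simp
  }
  {
    assume le: "real t \<le> real (card E) * m"
    define u where "u = real t / real (card E)"
    have "u \<le> m" using le cardE by (simp add: u_def field_simps)
    then have eq: "min (universal_density E I e) u = u" if "e \<in> E" for e
      using m(2)[OF that] by simp
    have "universal_density E (truncation t I) = (\<lambda>e. min (universal_density E I e) u)"
      using eq cardE by (intro universal_density_truncation) (simp_all add: u_def)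
    then show "homogeneous E (truncation t I)"
      unfolding homogeneous_def constant_on_def using eq by auto
  }
qed

text \<open>The bound \<open>1 \<le> |E| m\<close> makes the set of admissible \<open>t\<close> in the definition of balancity nonempty; it
  is also what makes the first breakpoint \<open>c_1\<close> positive.\<close>

theorem balancity_eq:
  assumes m: "m \<in> universal_density E I ` E" "\<And>e. e \<in> E \<Longrightarrow> m \<le> universal_density E I e"
  shows "int (balancity E I) = \<lfloor>real (card E) * m\<rfloor>" "1 \<le> real (card E) * m"
proof -
  define A where "A = {e \<in> E. universal_density E I e = m}"
  note A = minimal_density_level[OF m, folded A_def]
  have "1 \<le> m * real (card A)" using A(1,3) by linarith
  also have "\<dots> \<le> real (card E) * m"
    using A(4) finite_ground by (simp add: A_def mult.commute card_mono)
  finally show ge: "1 \<le> real (card E) * m" .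
  have "real (card E) * m \<le> sum (universal_density E I) E"
    using m(2) by (intro sum_bounded_below)
  also have "\<dots> = real (matroid_rank I E)" by (rule rank_polytopeD(4)[OF universal_density_in])
  finally have le: "real (card E) * m \<le> real (matroid_rank I E)" .
  define n where "n = nat \<lfloor>real (card E) * m\<rfloor>"
  have n_iff: "t \<le> n \<longleftrightarrow> real t \<le> real (card E) * m" for t
    using ge by (simp add: n_def le_nat_iff le_floor_iff)
  have "balancity E I = n"
    unfolding balancity_def
  proof (rule Greatest_equality)
    have "1 \<le> n" using n_iff[of 1] ge by simp
    moreover have n: "n \<le> matroid_rank I E" using n_iff[of n] le by simp
    ultimately show "1 \<le> n \<and> n \<le> matroid_rank I E \<and> homogeneous E (truncation n I)"
      using homogeneous_truncation_iff[OF m n] n_iff[of n] by simp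
    show "t \<le> n" if "1 \<le> t \<and> t \<le> matroid_rank I E \<and> homogeneous E (truncation t I)" for t
      using homogeneous_truncation_iff[OF m, of t] n_iff[of t] that by simp
  qed
  then show "int (balancity E I) = \<lfloor>real (card E) * m\<rfloor>" using ge by (simp add: n_def)
qed

lemma loopless_contraction_level:
  fixes u :: real
  defines "X \<equiv> {e \<in> E. universal_density E I e < u}"
  assumes "X \<noteq> E"
  shows "loopless_matroid (E - X) (contraction E I X)"
proof -
  interpret C: matroid "E - X" "contraction E I X" by (rule matroid_contraction)
  let ?x = "universal_density E I"
  have XE: "X \<subseteq> E" by (auto simp: X_def)
  have indep: "{e} \<in> contraction E I X" if e: "e \<in> E - X" for e
  proof -
    have "sum ?x X = real (matroid_rank I X)"
      using universal_density_levels by (simp add: tight_levels_def tight_def X_def)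
    moreover have "sum ?x (X \<union> {e}) = sum ?x X + ?x e"
      using e finite_subset_ground[OF XE] by simp
    moreover have "sum ?x (X \<union> {e}) \<le> real (matroid_rank I (X \<union> {e}))"
      using XE e by (intro rank_polytopeD(3)[OF universal_density_in]) auto
    ultimately have "matroid_rank I X < matroid_rank I (X \<union> {e})"
      using universal_density_pos[of e] e by simp
    moreover have "matroid_rank I (X \<union> {e}) \<le> matroid_rank I X + 1"
      using rank_submodular[of X "{e}"] rank_le_card[of "{e}"] by simp
    ultimately show ?thesis using e by (simp add: contraction_def)
  qed
  show ?thesis
  proof unfold_locales
    obtain e where "e \<in> E - X" using \<open>X \<noteq> E\<close> XE by blast
    then show "0 < matroid_rank (contraction E I X) (E - X)"
      using C.card_le_rank[OF indep, of e "E - X"] by simp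
  qed (rule indep)
qed

end

section \<open>The densities of the truncations\<close>

text \<open>When no density value lies strictly between \<open>u\<close> and \<open>w\<close>, capping at \<open>u\<close> changes nothing on the
  tight set of densities below \<open>w\<close> and gives the constant \<open>u\<close> on the rest.\<close>

lemma (in matroid) sum_min_universal_density:
  assumes "u \<le> w" and gap: "\<And>e. e \<in> E \<Longrightarrow> universal_density E I e < w \<Longrightarrow> universal_density E I e \<le> u"
  defines "T \<equiv> {e \<in> E. universal_density E I e \<ge> w}"
  shows "(\<Sum>e\<in>E. min (universal_density E I e) u)
    = real (card T) * u + real (matroid_rank I (E - T))"
proof -
  let ?x = "universal_density E I"
  have "E - T = {e \<in> E. ?x e < w}" by (auto simp: T_def)
  then have "sum ?x (E - T) = real (matroid_rank I (E - T))"
    using universal_density_levels by (simp add: tight_levels_def tight_def)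
  moreover have "(\<Sum>e\<in>E - T. min (?x e) u) = sum ?x (E - T)"
    using gap by (intro sum.cong) (auto simp: T_def min_def not_le)
  moreover have "(\<Sum>e\<in>T. min (?x e) u) = (\<Sum>e\<in>T. u)"
    using \<open>u \<le> w\<close> by (intro sum.cong) (auto simp: T_def)
  ultimately show ?thesis
    using sum.subset_diff[of T E "\<lambda>e. min (?x e) u"] finite_ground by (simp add: T_def)
qed

theorem theorem3p5:
  fixes E :: "'a set" and I :: "'a set set"
    and k :: nat and s :: "nat \<Rightarrow> real"
    and Ei :: "nat \<Rightarrow> 'a set" and b c :: "nat \<Rightarrow> int"
  assumes M: "loopless_matroid E I"
    and s_increasing: "strict_mono_on {1..k} s"
    and s_values: "s ` {1..k} = universal_density E I ` E"
    and Ei: "\<And>i. i \<in> {1..k} \<Longrightarrow> Ei i = {e \<in> E. universal_density E I e \<ge> s i}"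
    and b: "\<And>i. i \<in> {1..k} \<Longrightarrow> b i = \<lfloor>real (card (Ei i)) * s i\<rfloor>"
    and c: "\<And>i. i \<in> {1..k} \<Longrightarrow> c i = \<lfloor>real (card (Ei i)) * s i\<rfloor> + int (matroid_rank I (E - Ei i))"
    and c0: "c 0 = 0"
  shows
    "(\<forall>i\<in>{1..k}.
        loopless_matroid (E - (E - Ei i)) (contraction E I (E - Ei i)) \<and>
        b i = int (balancity (E - (E - Ei i)) (contraction E I (E - Ei i)))) \<and>
     (0 = c 0 \<and> c 0 < c 1 \<and> (\<forall>i. 1 \<le> i \<and> i + 1 \<le> k - 1 \<longrightarrow> c i \<le> c (i + 1)) \<and>
        c (k - 1) < c k \<and> c k = int (matroid_rank I E)) \<and>
     (\<forall>i\<in>{1..k}. c i - b i = int (matroid_rank I (E - Ei i)) \<and>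
        int (matroid_rank I (E - Ei i)) \<le> c (i - 1)) \<and>
     (\<forall>i\<in>{1..k}. \<forall>t::nat. c (i - 1) < int t \<and> int t \<le> c i \<longrightarrow>
        (\<forall>e\<in>E. universal_density E (truncation t I) e =
          (if e \<in> Ei i then (real t - real (matroid_rank I (E - Ei i))) / real (card (Ei i))
           else universal_density E I e)))"
proof -
  interpret loopless_matroid E I by (rule M)
  let ?x = "universal_density E I"
  define G where "G u = (\<Sum>e\<in>E. min (?x e) u)" for u
  \<comment> \<open>The value before \<open>s i\<close>. The convention \<open>p 1 = 0\<close> makes \<open>c (i - 1) = \<lfloor>G (p i)\<rfloor>\<close> hold for \<open>i = 1\<close> too.\<close>
  define p where "p i = (if i = 1 then 0 else s (i - 1))" for i :: nat
  have G_mono: "G u \<le> G v" if "u \<le> v" for u v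
    unfolding G_def using that by (intro sum_mono) auto
  have x_pos: "0 < ?x e" if "e \<in> E" for e using universal_density_pos[OF that] .
  have s_in: "s i \<in> ?x ` E" if "i \<in> {1..k}" for i using s_values that by blast
  have s_pos: "0 < s i" if "i \<in> {1..k}" for i using s_in[OF that] x_pos by auto
  have s_mono: "s i \<le> s j" if "i \<in> {1..k}" "j \<in> {1..k}" "i \<le> j" for i j
    using strict_mono_on_leD[OF s_increasing that] .
  have "?x ` E \<noteq> {}" using ground_nonempty by simp
  then have k: "1 \<le> k" using s_values by (cases k) auto
  have prev: "i - 1 \<in> {1..k}" if "i \<in> {1..k}" "i \<noteq> 1" for i using that by auto
  have p_less: "p i < s i" if i: "i \<in> {1..k}" for i
  proof (cases "i = 1")
    case False
    then have "s (i - 1) < s i" using strict_mono_onD[OF s_increasing prev[OF i] i] i by simp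
    then show ?thesis using False by (simp add: p_def)
  qed (use s_pos[OF i] in \<open>simp add: p_def\<close>)
  have p_nonneg: "0 \<le> p i" if i: "i \<in> {1..k}" for i
    using s_pos[OF prev[OF i]] by (cases "i = 1") (simp_all add: p_def)
  have gap: "?x e \<le> p i" if i: "i \<in> {1..k}" and e: "e \<in> E" "?x e < s i" for i e
  proof -
    obtain j where j: "j \<in> {1..k}" "?x e = s j" using e(1) s_values by (metis imageE imageI)
    then have "j < i" using e(2) s_mono[OF i j(1)] by (metis not_le)
    then have "i \<noteq> 1" "s j \<le> s (i - 1)" using j(1) i by (auto intro!: s_mono)
    then show ?thesis using j(2) by (simp add: p_def)
  qed
  \<comment> \<open>Between consecutive values of the density, \<open>G\<close> is affine.\<close>
  have G_eq: "G u = real (card (Ei i)) * u + real (matroid_rank I (E - Ei i))"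
    if i: "i \<in> {1..k}" and u: "p i \<le> u" "u \<le> s i" for i u
    unfolding G_def Ei[OF i] using u(1) gap[OF i]
    by (intro sum_min_universal_density[OF u(2)]) force
  have card_pos: "0 < card (Ei i)" if i: "i \<in> {1..k}" for i
    using s_in[OF i] finite_ground by (auto simp: card_gt_0_iff Ei[OF i])
  have c_eq: "c i = \<lfloor>G (s i)\<rfloor>" if i: "i \<in> {1..k}" for i
    using G_eq[OF i, of "s i"] p_less[OF i] c[OF i] by simp
  have "min (?x e) 0 = 0" if "e \<in> E" for e using x_pos[OF that] by simp
  then have "G 0 = 0" by (simp add: G_def)
  then have c_prev: "c (i - 1) = \<lfloor>G (p i)\<rfloor>" if i: "i \<in> {1..k}" for i
    using c0 c_eq[OF prev[OF i]] by (cases "i = 1") (simp_all add: p_def)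

  have part_i: "loopless_matroid (E - (E - Ei i)) (contraction E I (E - Ei i)) \<and>
      b i = int (balancity (E - (E - Ei i)) (contraction E I (E - Ei i)))" if i: "i \<in> {1..k}" for i
  proof -
    have X: "E - Ei i = {e \<in> E. ?x e < s i}" by (auto simp: Ei[OF i])
    have EX: "E - (E - Ei i) = Ei i" by (auto simp: Ei[OF i])
    have "E - Ei i \<noteq> E" using card_pos[OF i] EX by auto
    then have loopless: "loopless_matroid (E - (E - Ei i)) (contraction E I (E - Ei i))"
      unfolding X by (rule loopless_contraction_level)
    interpret C: loopless_matroid "Ei i" "contraction E I (E - Ei i)"
      using loopless unfolding EX .
    have y: "universal_density (Ei i) (contraction E I (E - Ei i)) e = ?x e" if "e \<in> Ei i" for e
      using universal_density_contraction[of "s i", folded X, unfolded EX] that by simp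
    have "s i \<in> ?x ` Ei i" using s_in[OF i] by (auto simp: Ei[OF i])
    then have "s i \<in> universal_density (Ei i) (contraction E I (E - Ei i)) ` Ei i"
      using y by (auto simp: image_iff)
    moreover have "s i \<le> universal_density (Ei i) (contraction E I (E - Ei i)) e"
      if "e \<in> Ei i" for e using y[OF that] that by (simp add: Ei[OF i])
    ultimately have "int (balancity (Ei i) (contraction E I (E - Ei i))) = b i"
      unfolding b[OF i] by (rule C.balancity_eq)
    then show ?thesis using loopless unfolding EX by simp
  qed

  have "c 0 < c 1"
  proof -
    have i: "1 \<in> {1..k}" using k by simp
    have min: "s 1 \<le> ?x e" if "e \<in> E" for e
      using gap[OF i that] x_pos[OF that] by (force simp: p_def)
    then have "Ei 1 = E" unfolding Ei[OF i] by auto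
    then have "1 \<le> G (s 1)"
      using balancity_eq(2)[OF s_in[OF i] min] G_eq[OF i, of "s 1"] p_less[OF i] by simp
    then have "1 \<le> c 1" unfolding c_eq[OF i] by simp
    then show ?thesis using c0 by simp
  qed
  moreover have "c i \<le> c (i + 1)" if "1 \<le> i" "i + 1 \<le> k - 1" for i
    using that s_mono[of i "i + 1"] c_eq[of i] c_eq[of "i + 1"] by (simp add: floor_mono G_mono)
  moreover have "c k = int (matroid_rank I E)" "c (k - 1) < c k"
  proof -
    have kk: "k \<in> {1..k}" using k by simp
    have "?x e \<le> s k" if e: "e \<in> E" for e
    proof -
      obtain j where "j \<in> {1..k}" "?x e = s j" using e s_values by (metis imageE imageI)
      then show ?thesis using s_mono[of j k] kk by simp
    qed
    then have "G (s k) = sum ?x E" unfolding G_def by (intro sum.cong) auto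
    also have "\<dots> = real (matroid_rank I E)" by (rule rank_polytopeD(4)[OF universal_density_in])
    finally have G_top: "G (s k) = real (matroid_rank I E)" .
    then show c_top: "c k = int (matroid_rank I E)" using c_eq[OF kk] by simp
    have "G (p k) < G (s k)"
      using G_eq[OF kk, of "p k"] G_eq[OF kk, of "s k"] p_less[OF kk] card_pos[OF kk] by simp
    then show "c (k - 1) < c k"
      unfolding c_top c_prev[OF kk] G_top by (simp add: floor_less_iff)
  qed
  ultimately have part_ii: "0 = c 0 \<and> c 0 < c 1 \<and>
      (\<forall>i. 1 \<le> i \<and> i + 1 \<le> k - 1 \<longrightarrow> c i \<le> c (i + 1)) \<and>
      c (k - 1) < c k \<and> c k = int (matroid_rank I E)"
    using c0 by simp

  have part_iii: "c i - b i = int (matroid_rank I (E - Ei i)) \<and>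
      int (matroid_rank I (E - Ei i)) \<le> c (i - 1)" if i: "i \<in> {1..k}" for i
  proof -
    have "0 \<le> p i" by (rule p_nonneg[OF i])
    then have "real (matroid_rank I (E - Ei i)) \<le> G (p i)"
      using G_eq[OF i, of "p i"] p_less[OF i] by simp
    then show ?thesis unfolding c_prev[OF i] using b[OF i] c[OF i] by (simp add: le_floor_iff)
  qed

  have part_iv: "universal_density E (truncation t I) e =
      (if e \<in> Ei i then (real t - real (matroid_rank I (E - Ei i))) / real (card (Ei i)) else ?x e)"
    if i: "i \<in> {1..k}" and t: "c (i - 1) < int t" "int t \<le> c i" and e: "e \<in> E" for i t e
  proof -
    define u where "u = (real t - real (matroid_rank I (E - Ei i))) / real (card (Ei i))"
    have t_eq: "real t = real (card (Ei i)) * u + real (matroid_rank I (E - Ei i))"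
      using card_pos[OF i] by (simp add: u_def)
    have "G (p i) < real t" "real t \<le> G (s i)"
      using t unfolding c_prev[OF i] c_eq[OF i] by (simp_all add: floor_less_iff le_floor_iff)
    then have u: "p i \<le> u" "u \<le> s i"
      using G_eq[OF i, of "p i"] G_eq[OF i, of "s i"] p_less[OF i] card_pos[OF i]
      unfolding t_eq by simp_all
    have "0 \<le> u" using u(1) p_nonneg[OF i] by simp
    moreover have "(\<Sum>e\<in>E. min (?x e) u) = real t"
      using G_eq[OF i u] unfolding t_eq G_def .
    ultimately have "universal_density E (truncation t I) e = min (?x e) u"
      using universal_density_truncation by metis
    also have "\<dots> = (if e \<in> Ei i then u else ?x e)"
      using gap[OF i e] u e by (auto simp: Ei[OF i])
    finally show ?thesis unfolding u_def .
  qed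

  show ?thesis using part_i part_ii part_iii part_iv by blast
qed

end
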